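(* Let $(W,S)$ be a finite Coxeter system, let $w\in W$ with a fixed reduced expression $w=s_1\cdots s_k$, and let $\mathcal{C}^\downarrow$ and $\phi:\mathcal{C}^\downarrow\to[e,w]$, $\phi(C)=p(C)w$, be as in the context. Then $\phi$ is injective.
   Context: $(W,S)$ is a finite Coxeter system, realized as a finite reflection group acting on a real vector space $V$ in a natural geometric representation (each $s\in S$ acts as a reflection and no nonzero vector is fixed by all of $W$). $T=\{usu^{-1}: s\in S,u\in W\}$; each $t\in T$ is the reflection through a hyperplane. Bruhat order: $u\le w$ iff some reduced expression for $w$ contains a subword expressing $u$; $[e,w]=\{u: u\le w\}$. Put $t_i=s_1\cdots s_{i-1}s_is_{i-1}\cdots s_1$ and let $H_i$ be its reflecting hyperplane; $\mathcal{A}_w=\{H_1,\dots,H_k\}$ with total order $H_1>\cdots>H_k$. $L_w$ is the set of intersections of subsets of $\mathcal{A}_w$ ($\hat0=V$), ordered by reverse inclusion, covering relation $\lhd$. $\lambda(A\lhd B)=\min\{H\in\mathcal{A}_w: H\supseteq B, H\not\supseteq A\}$. A saturated chain $\hat0=X_0\lhd\cdots\lhd X_m$ is $\lambda$-decreasing if $\lambda(X_{i-1}\lhd X_i)>\lambda(X_i\lhd X_{i+1})$ for all $i\in[m-1]$; $\mathcal{C}^\downarrow$ is the set of such chains (including $\{\hat0\}$). If $\lambda(X_{i-1}\lhd X_i)=H_{j_i}$ then $p(C)=t_{j_1}\cdots t_{j_m}$. It is known that $p(C)w\le w$ for $C\in\mathcal{C}^\downarrow$, so $\phi(C)=p(C)w$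 maps $\mathcal{C}^\downarrow$ into $[e,w]$. *)

theory Defs
  imports Complex_Main "HOL-Algebra.Generated_Groups" "HOL-Library.Sublist"
begin

section \<open>Coxeter systems\<close>

definition word_prod :: "('g, 'z) monoid_scheme \<Rightarrow> 'g list \<Rightarrow> 'g" where
  "word_prod W us = foldr (mult W) us (one W)"

text \<open>The entry 0 of a Coxeter matrix stands for infinity: the relator it yields is the empty word.\<close>

definition coxeter_matrix :: "'g set \<Rightarrow> ('g \<Rightarrow> 'g \<Rightarrow> nat) \<Rightarrow> bool" where
  "coxeter_matrix S m \<longleftrightarrow>
     (\<forall>s\<in>S. m s s = 1) \<and>
     (\<forall>s\<in>S. \<forall>t\<in>S. m s t = m t s) \<and>
     (\<forall>s\<in>S. \<forall>t\<in>S. s \<noteq> t \<longrightarrow> m s t \<noteq> 1)"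

text \<open>Deleting one occurrence of a relator $(st)^{m(s,t)}$ from a word.\<close>

definition relator_step :: "'g set \<Rightarrow> ('g \<Rightarrow> 'g \<Rightarrow> nat) \<Rightarrow> 'g list \<Rightarrow> 'g list \<Rightarrow> bool" where
  "relator_step S m u v \<longleftrightarrow>
     (\<exists>xs ys s t. s \<in> S \<and> t \<in> S \<and>
        u = xs @ concat (replicate (m s t) [s, t]) @ ys \<and> v = xs @ ys)"

text \<open>
  The last clause says that $W$ has the presentation $\langle S \mid (st)^{m(s,t)} = 1\rangle$.
  As $m(s,s) = 1$, every generator is its own inverse, so positive words suffice.
\<close>

definition coxeter_system :: "('g, 'z) monoid_scheme \<Rightarrow> 'g set \<Rightarrow> bool" where
  "coxeter_system W S \<longleftrightarrow>
     group W \<and> S \<subseteq> carrier W \<and> generate W S = carrier W \<and>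
     (\<exists>m. coxeter_matrix S m \<and>
        (\<forall>u\<in>lists S. \<forall>v\<in>lists S.
           word_prod W u = word_prod W v \<longleftrightarrow> equivclp (relator_step S m) u v))"

definition reduced_expression ::
    "('g, 'z) monoid_scheme \<Rightarrow> 'g set \<Rightarrow> 'g \<Rightarrow> 'g list \<Rightarrow> bool" where
  "reduced_expression W S w ss \<longleftrightarrow>
     ss \<in> lists S \<and> word_prod W ss = w \<and>
     (\<forall>us\<in>lists S. word_prod W us = w \<longrightarrow> length ss \<le> length us)"

definition bruhat_le :: "('g, 'z) monoid_scheme \<Rightarrow> 'g set \<Rightarrow> 'g \<Rightarrow> 'g \<Rightarrow> bool" where
  "bruhat_le W S u w \<longleftrightarrow>
     (\<exists>ss us. reduced_expression W S w ss \<and> subseq us ss \<and> word_prod W us = u)"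

text \<open>The interval $[e,w]$.\<close>

definition bruhat_lower_interval :: "('g, 'z) monoid_scheme \<Rightarrow> 'g set \<Rightarrow> 'g \<Rightarrow> 'g set" where
  "bruhat_lower_interval W S w = {u \<in> carrier W. bruhat_le W S u w}"


section \<open>Realization as a reflection group\<close>

definition linear_hyperplane :: "'v::real_vector set \<Rightarrow> bool" where
  "linear_hyperplane H \<longleftrightarrow>
     (\<exists>f :: 'v \<Rightarrow> real. linear f \<and> (\<exists>x. f x \<noteq> 0) \<and> H = {x. f x = 0})"

definition is_reflection :: "('v::real_vector \<Rightarrow> 'v) \<Rightarrow> bool" where
  "is_reflection r \<longleftrightarrow>
     linear r \<and>
     (\<exists>H. linear_hyperplane H \<and> (\<forall>x\<in>H. r x = x)) \<and>
     (\<exists>a. a \<noteq> 0 \<and> r a = - a)"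

text \<open>
  Injectivity of \<open>\<rho>\<close> expresses that $W$ is realized as a group of linear maps. The vector space
  $V$ is the whole type \<open>'v\<close>; no inner product is fixed on it.
\<close>

definition reflection_realization ::
    "('g, 'z) monoid_scheme \<Rightarrow> 'g set \<Rightarrow> ('g \<Rightarrow> 'v::real_vector \<Rightarrow> 'v) \<Rightarrow> bool" where
  "reflection_realization W S \<rho> \<longleftrightarrow>
     (\<forall>g\<in>carrier W. linear (\<rho> g)) \<and>
     \<rho> (one W) = id \<and>
     (\<forall>g\<in>carrier W. \<forall>h\<in>carrier W. \<rho> (mult W g h) = \<rho> g \<circ> \<rho> h) \<and>
     inj_on \<rho> (carrier W) \<and>
     (\<forall>s\<in>S. is_reflection (\<rho> s)) \<and>
     (\<forall>v. (\<forall>g\<in>carrier W. \<rho> g v = v) \<longrightarrow> v = 0)"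

definition fixed_space :: "('g \<Rightarrow> 'v::real_vector \<Rightarrow> 'v) \<Rightarrow> 'g \<Rightarrow> 'v set" where
  "fixed_space \<rho> g = {v. \<rho> g v = v}"


section \<open>The arrangement of a reduced expression and its intersection lattice\<close>

text \<open>
  Letters are numbered from 0: \<open>tref W ss i\<close> is $t_{i+1}$ and \<open>hyp W \<rho> ss i\<close> is $H_{i+1}$.
\<close>

definition tref :: "('g, 'z) monoid_scheme \<Rightarrow> 'g list \<Rightarrow> nat \<Rightarrow> 'g" where
  "tref W ss i = word_prod W (take i ss @ [ss ! i] @ rev (take i ss))"

definition hyp ::
    "('g, 'z) monoid_scheme \<Rightarrow> ('g \<Rightarrow> 'v::real_vector \<Rightarrow> 'v) \<Rightarrow> 'g list \<Rightarrow> nat \<Rightarrow> 'v set" where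
  "hyp W \<rho> ss i = fixed_space \<rho> (tref W ss i)"

definition arr ::
    "('g, 'z) monoid_scheme \<Rightarrow> ('g \<Rightarrow> 'v::real_vector \<Rightarrow> 'v) \<Rightarrow> 'g list \<Rightarrow> 'v set set" where
  "arr W \<rho> ss = hyp W \<rho> ss ` {..<length ss}"

text \<open>The order $H_1 > \dots > H_k$: a larger index means a smaller hyperplane.\<close>

definition arr_less ::
    "('g, 'z) monoid_scheme \<Rightarrow> ('g \<Rightarrow> 'v::real_vector \<Rightarrow> 'v) \<Rightarrow> 'g list \<Rightarrow>
     'v set \<Rightarrow> 'v set \<Rightarrow> bool" where
  "arr_less W \<rho> ss H K \<longleftrightarrow>
     (\<exists>i j. i < j \<and> j < length ss \<and> K = hyp W \<rho> ss i \<and> H = hyp W \<rho> ss j)"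

text \<open>The empty intersection is the whole space.\<close>

definition int_lattice ::
    "('g, 'z) monoid_scheme \<Rightarrow> ('g \<Rightarrow> 'v::real_vector \<Rightarrow> 'v) \<Rightarrow> 'g list \<Rightarrow> 'v set set" where
  "int_lattice W \<rho> ss = {\<Inter>\<B> | \<B>. \<B> \<subseteq> arr W \<rho> ss}"

text \<open>\<open>A \<lhd> B\<close> for the order by reverse inclusion.\<close>

definition covered_by ::
    "('g, 'z) monoid_scheme \<Rightarrow> ('g \<Rightarrow> 'v::real_vector \<Rightarrow> 'v) \<Rightarrow> 'g list \<Rightarrow>
     'v set \<Rightarrow> 'v set \<Rightarrow> bool" where
  "covered_by W \<rho> ss A B \<longleftrightarrow>
     A \<in> int_lattice W \<rho> ss \<and> B \<in> int_lattice W \<rho> ss \<and> B \<subset> A \<and>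
     \<not> (\<exists>Z\<in>int_lattice W \<rho> ss. B \<subset> Z \<and> Z \<subset> A)"

definition edge_label ::
    "('g, 'z) monoid_scheme \<Rightarrow> ('g \<Rightarrow> 'v::real_vector \<Rightarrow> 'v) \<Rightarrow> 'g list \<Rightarrow>
     'v set \<Rightarrow> 'v set \<Rightarrow> 'v set" where
  "edge_label W \<rho> ss A B =
     (let M = {H \<in> arr W \<rho> ss. B \<subseteq> H \<and> \<not> A \<subseteq> H}
      in THE H. H \<in> M \<and> (\<forall>K\<in>M. K \<noteq> H \<longrightarrow> arr_less W \<rho> ss H K))"

text \<open>A chain $X_0 \lhd \dots \lhd X_m$ is the list $[X_0,\dots,X_m]$; it has $m$ labels.\<close>

definition chain_labels ::
    "('g, 'z) monoid_scheme \<Rightarrow> ('g \<Rightarrow> 'v::real_vector \<Rightarrow> 'v) \<Rightarrow> 'g list \<Rightarrow>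
     'v set list \<Rightarrow> 'v set list" where
  "chain_labels W \<rho> ss C = map2 (edge_label W \<rho> ss) C (tl C)"

definition decreasing_chains ::
    "('g, 'z) monoid_scheme \<Rightarrow> ('g \<Rightarrow> 'v::real_vector \<Rightarrow> 'v) \<Rightarrow> 'g list \<Rightarrow> 'v set list set" where
  "decreasing_chains W \<rho> ss =
     {C. C \<noteq> [] \<and> hd C = UNIV \<and> successively (covered_by W \<rho> ss) C \<and>
         successively (\<lambda>H K. arr_less W \<rho> ss K H) (chain_labels W \<rho> ss C)}"

text \<open>The index of a hyperplane is unique because the $H_i$ are pairwise distinct.\<close>

definition hyp_index ::
    "('g, 'z) monoid_scheme \<Rightarrow> ('g \<Rightarrow> 'v::real_vector \<Rightarrow> 'v) \<Rightarrow> 'g list \<Rightarrow> 'v set \<Rightarrow> nat" where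
  "hyp_index W \<rho> ss H = (THE j. j < length ss \<and> hyp W \<rho> ss j = H)"

definition chain_prod ::
    "('g, 'z) monoid_scheme \<Rightarrow> ('g \<Rightarrow> 'v::real_vector \<Rightarrow> 'v) \<Rightarrow> 'g list \<Rightarrow> 'v set list \<Rightarrow> 'g" where
  "chain_prod W \<rho> ss C =
     word_prod W (map (\<lambda>H. tref W ss (hyp_index W \<rho> ss H)) (chain_labels W \<rho> ss C))"

definition chain_map ::
    "('g, 'z) monoid_scheme \<Rightarrow> ('g \<Rightarrow> 'v::real_vector \<Rightarrow> 'v) \<Rightarrow> 'g list \<Rightarrow> 'g \<Rightarrow>
     'v set list \<Rightarrow> 'g" where
  "chain_map W \<rho> ss w C = mult W (chain_prod W \<rho> ss C) w"

end

theory Submission imports Defs begin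

text \<open>
  The product \<open>p(C)\<close> of a decreasing chain determines the chain from its end. Averaging over the
  finite group gives a $W$-invariant definite form, and orthogonality with respect to it shows that
  the fixed space of \<open>p(C)\<close> is the last element $X_m$ of \<open>C\<close> (a form of Carter's lemma). Since the
  labels decrease, the last label is the smallest hyperplane of the arrangement containing $X_m$,
  so it is determined by $X_m$ as well. Cancelling the corresponding reflection and inducting
  recovers the chain. That \<open>p(C) w\<close> lies below \<open>w\<close> holds because multiplying by the $t_j$ deletes
  the letters with these indices from the reduced word.
\<close>

section \<open>Words in involutions\<close>

lemma subseq_set: "subseq xs ys \<Longrightarrow> set xs \<subseteq> set ys"
  by (induction rule: list_emb.induct) auto

context group
begin

lemma word_prod_Nil: "word_prod G [] = \<one>"
  by (simp add: word_prod_def)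

lemma word_prod_Cons: "word_prod G (x # xs) = x \<otimes> word_prod G xs"
  by (simp add: word_prod_def)

lemma word_prod_closed: "set xs \<subseteq> carrier G \<Longrightarrow> word_prod G xs \<in> carrier G"
  by (induction xs) (auto simp: word_prod_Nil word_prod_Cons)

lemma word_prod_append:
  "set xs \<subseteq> carrier G \<Longrightarrow> set ys \<subseteq> carrier G \<Longrightarrow>
     word_prod G (xs @ ys) = word_prod G xs \<otimes> word_prod G ys"
  by (induction xs) (auto simp: word_prod_Nil word_prod_Cons word_prod_closed m_assoc)

lemma word_prod_rev:
  assumes "set xs \<subseteq> carrier G" "\<And>x. x \<in> set xs \<Longrightarrow> x \<otimes> x = \<one>"
  shows "word_prod G (rev xs) = inv (word_prod G xs)"
  using assms
proof (induction xs)
  case Nil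
  then show ?case by (simp add: word_prod_Nil)
next
  case (Cons x xs)
  have x: "x \<in> carrier G" "x \<otimes> x = \<one>" and xs: "set xs \<subseteq> carrier G"
    using Cons.prems by auto
  have "inv x = x" using x by (metis inv_equality)
  then show ?case
    using Cons x xs by (simp add: word_prod_append word_prod_Cons word_prod_Nil word_prod_closed inv_mult_group)
qed

end

section \<open>The reflections t_i of a word and the deletion of letters\<close>

locale involution_word = group W for W (structure) +
  fixes ss :: "'a list"
  assumes ss_carrier: "set ss \<subseteq> carrier W"
    and ss_involution: "s \<in> set ss \<Longrightarrow> s \<otimes> s = \<one>"
begin

lemma take_carrier: "set (take i ss) \<subseteq> carrier W"
  using ss_carrier set_take_subset by fastforce

text \<open>The letters are involutions, so the reversed prefix is the inverse of the prefix and the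
  palindrome becomes a conjugate of \<open>ss ! i\<close>.\<close>

lemma tref_conj:
  assumes "i < length ss"
  shows "tref W ss i = word_prod W (take i ss) \<otimes> ss ! i \<otimes> inv (word_prod W (take i ss))"
proof -
  have "ss ! i \<in> carrier W" using assms ss_carrier by auto
  moreover have "word_prod W (rev (take i ss)) = inv (word_prod W (take i ss))"
    using take_carrier ss_involution by (intro word_prod_rev) (auto dest: in_set_takeD)
  ultimately show ?thesis
    unfolding tref_def using take_carrier[of i]
    by (simp add: word_prod_append word_prod_Cons word_prod_closed m_assoc)
qed

lemma tref_closed: "i < length ss \<Longrightarrow> tref W ss i \<in> carrier W"
  using take_carrier[of i] subsetD[OF ss_carrier nth_mem[of i]] by (simp add: tref_conj word_prod_closed)

text \<open>With prefix u, letter s and tail v, the product of u s u^-1 and u s v is u v. The tail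
  \<open>us\<close> is arbitrary because letters further right may already have been
  deleted.\<close>

lemma tref_mult:
  assumes i: "i < length ss" and us: "set us \<subseteq> carrier W"
  shows "tref W ss i \<otimes> word_prod W (take (Suc i) ss @ us) = word_prod W (take i ss @ us)"
proof -
  let ?u = "word_prod W (take i ss)" and ?v = "word_prod W us" and ?s = "ss ! i"
  have c: "?u \<in> carrier W" "?v \<in> carrier W" "?s \<in> carrier W" "?s \<otimes> ?s = \<one>"
    using i us take_carrier ss_carrier ss_involution by (auto simp: word_prod_closed)
  have e: "word_prod W (take (Suc i) ss @ us) = ?u \<otimes> (?s \<otimes> ?v)"
    using i us take_carrier[of i] c
    by (simp add: take_Suc_conv_app_nth word_prod_append word_prod_Cons word_prod_closed m_assoc)
  have "inv ?u \<otimes> (?u \<otimes> (?s \<otimes> ?v)) = ?s \<otimes> ?v"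
    using c by (simp add: m_assoc[symmetric])
  moreover have "?s \<otimes> (?s \<otimes> ?v) = ?v" using c by (simp add: m_assoc[symmetric])
  ultimately have "tref W ss i \<otimes> (?u \<otimes> (?s \<otimes> ?v)) = ?u \<otimes> ?v"
    using i c by (simp add: tref_conj m_assoc)
  then show ?thesis
    using e us take_carrier[of i] by (simp add: word_prod_append)
qed

lemma tref_involution:
  assumes "i < length ss" shows "tref W ss i \<otimes> tref W ss i = \<one>"
proof -
  let ?u = "word_prod W (take i ss)" and ?s = "ss ! i"
  have c: "?u \<in> carrier W" "?s \<in> carrier W" "?s \<otimes> ?s = \<one>"
    using assms take_carrier ss_carrier ss_involution by (auto simp: word_prod_closed)
  have "inv ?u \<otimes> (?u \<otimes> (?s \<otimes> inv ?u)) = ?s \<otimes> inv ?u" "?s \<otimes> (?s \<otimes> inv ?u) = inv ?u"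
    using c by (simp_all add: m_assoc[symmetric])
  then show ?thesis using assms c by (simp add: tref_conj m_assoc)
qed

text \<open>The factor with the largest index acts first, so each reflection meets an intact prefix
  up to its own letter and deletes that letter. The bound \<open>n\<close> records in the induction
  that the first \<open>n\<close> letters stay untouched. The length count shows when reducedness is
  violated; the subsequence gives Bruhat comparisons.\<close>

lemma delete_letters:
  assumes "sorted_wrt (<) js" "\<forall>j\<in>set js. n \<le> j \<and> j < length ss"
  shows "\<exists>us. subseq us (drop n ss) \<and> length us + length js = length (drop n ss) \<and>
           word_prod W (map (tref W ss) js) \<otimes> word_prod W ss = word_prod W (take n ss @ us)"
  using assms
proof (induction js arbitrary: n)
  case Nil
  then show ?case
    using ss_carrier by (intro exI[of _ "drop n ss"]) (simp add: word_prod_Nil word_prod_closed)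
next
  case (Cons j js)
  from Cons.prems have j: "n \<le> j" "j < length ss" by auto
  have "sorted_wrt (<) js" "\<forall>i\<in>set js. Suc j \<le> i \<and> i < length ss"
    using Cons.prems by (auto simp: Suc_le_eq)
  from Cons.IH[OF this] obtain us where
    us: "subseq us (drop (Suc j) ss)" "length us + length js = length (drop (Suc j) ss)"
      "word_prod W (map (tref W ss) js) \<otimes> word_prod W ss = word_prod W (take (Suc j) ss @ us)"
    by blast
  have usc: "set us \<subseteq> carrier W"
    using subseq_set[OF us(1)] ss_carrier set_drop_subset[of "Suc j" ss] by blast
  \<comment> \<open>The letters at positions from \<open>n\<close> to \<open>j - 1\<close> survive
    and are prepended to the remainder supplied by the induction hypothesis.\<close>
  have split: "take j ss = take n ss @ take (j - n) (drop n ss)"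
    using j take_add[of n "j - n" ss] by simp
  have "drop n ss = take (j - n) (drop n ss) @ drop j ss"
    using j append_take_drop_id[of "j - n" "drop n ss"] by simp
  moreover have "subseq us (drop j ss)"
    using us(1) j Cons_nth_drop_Suc[of j ss] by (metis list_emb_Cons)
  ultimately have sub: "subseq (take (j - n) (drop n ss) @ us) (drop n ss)"
    using list_emb_append_mono[OF subseq_order.order_refl[of "take (j - n) (drop n ss)"]] by metis
  have c: "set (map (tref W ss) js) \<subseteq> carrier W"
    using Cons.prems by (auto simp: tref_closed)
  have "word_prod W (map (tref W ss) (j # js)) \<otimes> word_prod W ss
      = tref W ss j \<otimes> word_prod W (take (Suc j) ss @ us)"
    using j us(3) word_prod_closed[OF c] word_prod_closed[OF ss_carrier]
    by (simp add: word_prod_Cons m_assoc tref_closed)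
  also have "\<dots> = word_prod W (take n ss @ (take (j - n) (drop n ss) @ us))"
    using tref_mult[OF j(2) usc] split by simp
  finally show ?case
    using sub us(2) j by (intro exI[of _ "take (j - n) (drop n ss) @ us"]) auto
qed

end

section \<open>Reflections and invariant forms\<close>

text \<open>The functional \<open>h\<close> of the hyperplane does not vanish at the negated vector
  \<open>a\<close>, as \<open>a\<close> would otherwise be both fixed and negated. Rescaling
  \<open>h\<close> to take the value 2 at \<open>a\<close> gives the coroot
  \<open>f\<close>.\<close>

lemma is_reflection_coroot:
  fixes r :: "'v::real_vector \<Rightarrow> 'v"
  assumes "is_reflection r"
  obtains f :: "'v \<Rightarrow> real" and a where "linear f" "f a = 2" "\<And>v. r v = v - f v *\<^sub>R a"
proof -
  obtain h :: "'v \<Rightarrow> real" and a where r: "linear r" and h: "linear h" "\<forall>x. h x = 0 \<longrightarrow> r x = x"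
    and a: "a \<noteq> 0" "r a = - a"
    using assms unfolding is_reflection_def linear_hyperplane_def by blast
  have ha: "h a \<noteq> 0"
  proof
    assume "h a = 0"
    then have "a = - a" using h a by auto
    then have "2 *\<^sub>R a = 0" by (metis ab_left_minus scaleR_2)
    then show False using a by simp
  qed
  define f where "f = (\<lambda>v. (2 / h a) *\<^sub>R h v)"
  have "linear f" unfolding f_def using h(1) by (rule linear_compose_scale_right)
  moreover have "f a = 2" using ha by (simp add: f_def)
  moreover have "r v = v - f v *\<^sub>R a" for v
  proof -
    \<comment> \<open>The projection of \<open>v\<close> to the hyperplane along
      \<open>a\<close>.\<close>
    define u where "u = v - (h v / h a) *\<^sub>R a"
    have "h u = 0" using ha by (simp add: u_def linear_diff[OF h(1)] linear_cmul[OF h(1)])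
    then have "r u = u" using h by blast
    moreover have "r u = r v + (h v / h a) *\<^sub>R a"
      by (simp add: u_def linear_diff[OF r] linear_cmul[OF r] a)
    moreover have "f v *\<^sub>R a = (h v / h a) *\<^sub>R a + (h v / h a) *\<^sub>R a"
      by (simp add: f_def flip: scaleR_left_distrib)
    ultimately show ?thesis by (simp add: u_def algebra_simps)
  qed
  ultimately show ?thesis by (rule that)
qed

lemma is_reflection_conj:
  fixes r :: "'v::real_vector \<Rightarrow> 'v"
  assumes "is_reflection r" "linear g" "linear g'" "\<And>v. g (g' v) = v" "\<And>v. g' (g v) = v"
  shows "is_reflection (g \<circ> r \<circ> g')"
proof -
  obtain h :: "'v \<Rightarrow> real" and a x where r: "linear r" and h: "linear h" "\<forall>x. h x = 0 \<longrightarrow> r x = x" "h x \<noteq> 0"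
    and a: "a \<noteq> 0" "r a = - a"
    using assms(1) unfolding is_reflection_def linear_hyperplane_def by blast
  have "linear_hyperplane {v. (h \<circ> g') v = 0}"
    unfolding linear_hyperplane_def
    using linear_compose[OF assms(3) h(1)] h(3) assms(5) by (intro exI[of _ "h \<circ> g'"]) (auto intro!: exI[of _ "g x"])
  moreover have "\<forall>v\<in>{v. (h \<circ> g') v = 0}. (g \<circ> r \<circ> g') v = v"
    using h assms by auto
  moreover have "linear (g \<circ> r \<circ> g')"
    using assms r by (intro linear_compose)
  moreover have "g a \<noteq> 0" using a assms by (metis linear_0)
  moreover have "(g \<circ> r \<circ> g') (g a) = - g a"
    using a assms by (simp add: linear_neg)
  ultimately show ?thesis unfolding is_reflection_def by blast
qed

section \<open>Orthogonality and reflections for a definite form\<close>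

locale definite_form =
  fixes B :: "'v::real_vector \<Rightarrow> 'v \<Rightarrow> real"
  assumes linear_left: "linear (\<lambda>x. B x y)"
    and sym: "B x y = B y x"
    and definite: "B x x = 0 \<Longrightarrow> x = 0"
begin

lemma diff_left: "B (x - y) z = B x z - B y z"
  using linear_diff[OF linear_left] .

lemma minus_left: "B (- x) z = - B x z"
  using linear_neg[OF linear_left] .

lemma diff_right: "B z (x - y) = B z x - B z y"
  using diff_left sym by metis

lemma scale_left: "B (c *\<^sub>R x) z = c * B x z"
  using linear_cmul[OF linear_left] by simp

definition isometry :: "('v \<Rightarrow> 'v) \<Rightarrow> bool" where
  "isometry g \<longleftrightarrow> (\<forall>x y. B (g x) (g y) = B x y)"

lemma isometry_diff_orthogonal_fixed:
  assumes "isometry g" "g x = x"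
  shows "B (g v - v) x = 0"
  using assms unfolding isometry_def by (metis diff_left diff_self)

text \<open>All displacements of \<open>r\<close> are multiples of one root \<open>a\<close>. If
  \<open>v\<close> moves, \<open>a\<close> is orthogonal to \<open>x\<close>, hence so is
  \<open>r x - x\<close>. For an isometry, \<open>r x - x\<close> paired with itself is twice
  \<open>B x x - B (r x) x\<close>, which is then 0, so \<open>x\<close> would be fixed.\<close>

lemma reflection_fixes_if_orthogonal:
  assumes "is_reflection r" "isometry r" "r x \<noteq> x" "B (r v - v) x = 0"
  shows "r v = v"
proof -
  obtain f a where f: "linear f" "f a = 2" "\<And>v. r v = v - f v *\<^sub>R a"
    using is_reflection_coroot[OF assms(1)] by metis
  have d: "B (r u - u) y = - f u * B a y" for u y
    by (simp add: f minus_left scale_left)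
  show ?thesis
  proof (rule ccontr)
    assume "r v \<noteq> v"
    then have "f v \<noteq> 0" using f(3)[of v] by auto
    then have "B a x = 0" using assms(4) d[of v x] by simp
    then have "B (r x - x) x = 0" using d[of x x] by simp
    then have "B (r x) x = B x x" by (simp add: diff_left)
    then have "B (r x - x) (r x - x) = 0"
      using assms(2) sym[of x "r x"] by (simp add: diff_left diff_right isometry_def)
    then show False using definite assms(3) by fastforce
  qed
qed

text \<open>Both roots are orthogonal to the common hyperplane, hence proportional by definiteness.
  The coroots have the same kernel, and their values 2 on the roots fix the remaining
  scalar.\<close>

lemma reflection_eqI:
  assumes r: "is_reflection r" "isometry r" and r': "is_reflection r'" "isometry r'"
    and eq: "{v. r v = v} = {v. r' v = v}"
  shows "r = r'"
proof
  fix v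
  obtain f a where f: "linear f" "f a = 2" "\<And>v. r v = v - f v *\<^sub>R a"
    using is_reflection_coroot[OF r(1)] by metis
  obtain f' a' where f': "linear f'" "f' a' = 2" "\<And>v. r' v = v - f' v *\<^sub>R a'"
    using is_reflection_coroot[OF r'(1)] by metis
  have "a \<noteq> 0" "a' \<noteq> 0" using f f' linear_0 by fastforce+
  then have fx: "r x = x \<longleftrightarrow> f x = 0" "r' x = x \<longleftrightarrow> f' x = 0" for x
    by (simp_all add: f(3) f'(3))
  then have ker: "f x = 0 \<longleftrightarrow> f' x = 0" for x using eq by blast
  have orth: "B a x = 0 \<and> B a' x = 0" if "f x = 0" for x
  proof -
    have "B (r a - a) x = 0" "B (r' a' - a') x = 0"
      using isometry_diff_orthogonal_fixed r(2) r'(2) fx ker that by auto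
    then show ?thesis by (simp add: f f' minus_left scale_left)
  qed
  \<comment> \<open>The scalar is chosen to put \<open>b\<close> into the hyperplane. Since
    \<open>b\<close> is a combination of the roots, it is also orthogonal to the hyperplane, hence
    to itself.\<close>
  define c where "c = f a' / 2"
  define b where "b = a' - c *\<^sub>R a"
  have "f b = 0" by (simp add: b_def c_def linear_diff[OF f(1)] linear_cmul[OF f(1)] f(2))
  from orth[OF this] have "B b b = 0" using b_def diff_left scale_left by simp
  then have a': "a' = c *\<^sub>R a" using definite[of b] by (simp add: b_def)
  then have c: "c * f' a = 2" using f' by (simp add: linear_cmul[OF f'(1)])
  \<comment> \<open>The part of \<open>v\<close> in the common kernel; that \<open>f'\<close>
    vanishes on it expresses \<open>f' v\<close> through \<open>f v\<close>.\<close>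
  define u where "u = v - (f v / 2) *\<^sub>R a"
  have "f u = 0" by (simp add: u_def linear_diff[OF f(1)] linear_cmul[OF f(1)] f(2))
  then have "f' u = 0" using ker by simp
  then have "f' v = f v / 2 * f' a" by (simp add: u_def linear_diff[OF f'(1)] linear_cmul[OF f'(1)])
  then have "f' v * c = f v / 2 * (c * f' a)" by simp
  then have "f' v * c = f v" using c by simp
  then show "r v = r' v" by (simp add: f f' a')
qed

end

text \<open>The averaged form is a sum of squares of functionals whose kernels are fixed by the
  generators. A vector killed by all of them is fixed by S, hence by W, hence zero, which gives
  definiteness.\<close>

lemma reflection_realization_invariant_form:
  fixes W (structure) and \<rho> :: "'g \<Rightarrow> 'v::real_vector \<Rightarrow> 'v"
  assumes "group W" "finite (carrier W)" "S \<subseteq> carrier W" "generate W S = carrier W"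
    and real: "reflection_realization W S \<rho>"
  obtains B where "definite_form B" "\<And>g. g \<in> carrier W \<Longrightarrow> definite_form.isometry B (\<rho> g)"
proof -
  interpret group W by fact
  have lin: "linear (\<rho> g)" if "g \<in> carrier W" for g
    using real that unfolding reflection_realization_def by blast
  have one: "\<rho> \<one> = id" and mult: "g \<in> carrier W \<Longrightarrow> h \<in> carrier W \<Longrightarrow> \<rho> (g \<otimes> h) = \<rho> g \<circ> \<rho> h" for g h
    using real unfolding reflection_realization_def by auto
  have fix0: "v = 0" if "\<And>g. g \<in> carrier W \<Longrightarrow> \<rho> g v = v" for v
    using real that unfolding reflection_realization_def by blast
  have "\<forall>s\<in>S. \<exists>f :: 'v \<Rightarrow> real. linear f \<and> (\<forall>v. f v = 0 \<longrightarrow> \<rho> s v = v)"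
  proof
    fix s assume "s \<in> S"
    then have "is_reflection (\<rho> s)" using real unfolding reflection_realization_def by blast
    then obtain f a where "linear f" "f a = 2" "\<And>v. \<rho> s v = v - f v *\<^sub>R a"
      using is_reflection_coroot by metis
    then show "\<exists>f :: 'v \<Rightarrow> real. linear f \<and> (\<forall>v. f v = 0 \<longrightarrow> \<rho> s v = v)"
      by (intro exI[of _ f]) auto
  qed
  then obtain f :: "'g \<Rightarrow> 'v \<Rightarrow> real" where f: "\<And>s. s \<in> S \<Longrightarrow> linear (f s)"
      "\<And>s v. s \<in> S \<Longrightarrow> f s v = 0 \<Longrightarrow> \<rho> s v = v"
    by metis
  have finS: "finite S" using assms finite_subset by blast
  define B where "B = (\<lambda>u v. \<Sum>g\<in>carrier W. \<Sum>s\<in>S. f s (\<rho> g u) * f s (\<rho> g v))"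
  have form: "definite_form B"
  proof (rule definite_form.intro)
    fix x y :: 'v
    have "linear (\<lambda>x. f s (\<rho> g x) * f s (\<rho> g y))" if "g \<in> carrier W" "s \<in> S" for g s
      by (rule linearI) (simp_all add: linear_add[OF lin[OF that(1)]] linear_add[OF f(1)[OF that(2)]]
          linear_cmul[OF lin[OF that(1)]] linear_cmul[OF f(1)[OF that(2)]] algebra_simps)
    then show "linear (\<lambda>x. B x y)" unfolding B_def by (intro linear_compose_sum ballI) auto
    show "B x y = B y x" unfolding B_def by (simp add: mult.commute)
    assume "B x x = 0"
    then have "(\<Sum>s\<in>S. f s (\<rho> g x) * f s (\<rho> g x)) = 0" if "g \<in> carrier W" for g
      unfolding B_def using that assms(2) by (subst (asm) sum_nonneg_eq_0_iff) (auto intro: sum_nonneg)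
    \<comment> \<open>The summand of the identity alone forces every \<open>f s\<close> to vanish at
      \<open>x\<close>.\<close>
    from this[of \<one>] have "\<forall>s\<in>S. f s x * f s x = 0"
      using finS by (simp add: one sum_nonneg_eq_0_iff)
    then have gen: "\<rho> s x = x" if "s \<in> S" for s using f that by auto
    have "\<rho> g x = x" if "g \<in> generate W S" for g
      using that
    proof (induction rule: generate.induct)
      case one
      then show ?case by (simp add: \<open>\<rho> \<one> = id\<close>)
    next
      case (incl h)
      then show ?case by (rule gen)
    next
      case (inv h)
      then have h: "h \<in> carrier W" using assms by auto
      have "\<rho> (inv h) (\<rho> h x) = x" using mult[of "inv h" h] h by (simp add: one comp_def fun_eq_iff)
      then show ?case using gen inv by simp
    next
      case (eng h1 h2)
      then show ?case using mult[of h1 h2] assms(4) by simp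
    qed
    then show "x = 0" using fix0 assms(4) by blast
  qed
  moreover have "definite_form.isometry B (\<rho> h)" if h: "h \<in> carrier W" for h
    unfolding definite_form.isometry_def[OF form]
  proof (intro allI)
    fix x y
    let ?F = "\<lambda>g. \<Sum>s\<in>S. f s (\<rho> g x) * f s (\<rho> g y)"
    have "B (\<rho> h x) (\<rho> h y) = (\<Sum>g\<in>carrier W. ?F (g \<otimes> h))"
      unfolding B_def using h by (intro sum.cong) (simp_all add: mult)
    \<comment> \<open>Right multiplication by \<open>h\<close> permutes the finite group, which
      makes the averaged form invariant.\<close>
    also have "\<dots> = (\<Sum>g\<in>carrier W. ?F g)"
      using h by (intro sum.reindex_bij_witness[where S = "carrier W" and T = "carrier W" and
            i = "\<lambda>g. g \<otimes> inv h" and j = "\<lambda>g. g \<otimes> h"]) (auto simp: m_assoc)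
    finally show "B (\<rho> h x) (\<rho> h y) = B x y" by (simp add: B_def)
  qed
  ultimately show ?thesis by (rule that)
qed

section \<open>Decreasing chains\<close>

locale reflection_word = group W + definite_form B
  for W :: "('g, 'z) monoid_scheme" (structure) and B :: "'v::real_vector \<Rightarrow> 'v \<Rightarrow> real" +
  fixes S :: "'g set" and \<rho> :: "'g \<Rightarrow> 'v \<Rightarrow> 'v" and ss :: "'g list"
  assumes S_carrier: "S \<subseteq> carrier W"
    and S_involution: "s \<in> S \<Longrightarrow> s \<otimes> s = \<one>"
    and realization: "reflection_realization W S \<rho>"
    and rho_isometry: "g \<in> carrier W \<Longrightarrow> isometry (\<rho> g)"
    and reduced: "reduced_expression W S (word_prod W ss) ss"
begin

lemma ss_S: "set ss \<subseteq> S"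
  using reduced unfolding reduced_expression_def by (auto simp: lists_eq_set)

sublocale involution_word W ss
  using ss_S S_carrier S_involution by unfold_locales auto

section \<open>The reflections and hyperplanes of a reduced word\<close>

abbreviation t where "t \<equiv> tref W ss"
abbreviation H where "H \<equiv> hyp W \<rho> ss"
abbreviation tprod where "tprod js \<equiv> word_prod W (map t js)"

lemma rho_linear: "g \<in> carrier W \<Longrightarrow> linear (\<rho> g)"
  and rho_one: "\<rho> \<one> = id"
  and rho_mult: "g \<in> carrier W \<Longrightarrow> h \<in> carrier W \<Longrightarrow> \<rho> (g \<otimes> h) = \<rho> g \<circ> \<rho> h"
  and rho_inj: "inj_on \<rho> (carrier W)"
  and rho_reflection: "s \<in> S \<Longrightarrow> is_reflection (\<rho> s)"
  using realization unfolding reflection_realization_def by auto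

lemma rho_inv:
  assumes "g \<in> carrier W"
  shows "\<rho> (inv g) (\<rho> g v) = v" "\<rho> g (\<rho> (inv g) v) = v"
  using rho_mult[of "inv g" g] rho_mult[of g "inv g"] assms
  by (simp_all add: rho_one fun_eq_iff)

lemma t_reflection:
  assumes "i < length ss" shows "is_reflection (\<rho> (t i))"
proof -
  let ?u = "word_prod W (take i ss)"
  have u: "?u \<in> carrier W" and s: "ss ! i \<in> S" "ss ! i \<in> carrier W"
    using take_carrier subsetD[OF ss_S nth_mem[OF assms]] S_carrier by (auto simp: word_prod_closed)
  have "\<rho> (t i) = \<rho> ?u \<circ> \<rho> (ss ! i) \<circ> \<rho> (inv ?u)"
    using assms u s by (simp add: tref_conj rho_mult)
  then show ?thesis
    using is_reflection_conj[OF rho_reflection[OF s(1)], of "\<rho> ?u" "\<rho> (inv ?u)"] u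
    by (simp add: rho_linear rho_inv)
qed

lemma tprod_closed: "set js \<subseteq> {..<length ss} \<Longrightarrow> tprod js \<in> carrier W"
  by (intro word_prod_closed) (auto simp: tref_closed)

lemma tprod_snoc:
  assumes "set js \<subseteq> {..<length ss}" "j < length ss"
  shows "tprod (js @ [j]) = tprod js \<otimes> t j"
proof -
  have "set (map t js) \<subseteq> carrier W" using assms by (auto simp: tref_closed)
  then show ?thesis using assms by (simp add: word_prod_append word_prod_Cons word_prod_Nil tref_closed)
qed

text \<open>Equal reflections would have product \<open>\<one>\<close>, yet multiplying by that
  product deletes two letters, giving a shorter word for the same element.\<close>

lemma t_neq:
  assumes "i < j" "j < length ss" shows "t i \<noteq> t j"
proof
  assume eq: "t i = t j"
  obtain us where us: "subseq us ss" "length us + 2 = length ss"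
      "tprod [i, j] \<otimes> word_prod W ss = word_prod W us"
    using delete_letters[of "[i, j]" 0] assms by auto
  have "tprod [i, j] = \<one>"
    using assms eq tref_involution[of j] by (simp add: word_prod_Cons word_prod_Nil tref_closed)
  then have "word_prod W us = word_prod W ss"
    using us(3) ss_carrier by (simp add: word_prod_closed)
  moreover have "us \<in> lists S" using subseq_set[OF us(1)] ss_S by auto
  ultimately show False using reduced us(2) unfolding reduced_expression_def by force
qed

text \<open>An isometric reflection is determined by its fixed hyperplane, and the realization is
  faithful. This makes \<open>hyp_index\<close> and the order \<open>arr_less\<close>
  meaningful.\<close>

lemma H_inj:
  assumes "i < length ss" "j < length ss" "H i = H j" shows "i = j"
proof -
  have "{v. \<rho> (t i) v = v} = {v. \<rho> (t j) v = v}"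
    using assms(3) by (simp add: hyp_def fixed_space_def)
  then have "\<rho> (t i) = \<rho> (t j)"
    using assms reflection_eqI[OF t_reflection rho_isometry t_reflection rho_isometry] tref_closed
    by blast
  then have "t i = t j" using inj_onD[OF rho_inj] assms tref_closed by blast
  then show ?thesis using t_neq assms by (metis linorder_neqE_nat)
qed

lemma H_neq_UNIV: "i < length ss \<Longrightarrow> H i \<noteq> UNIV"
proof -
  assume i: "i < length ss"
  obtain f a where "linear f" "f a = 2" "\<And>v. \<rho> (t i) v = v - f v *\<^sub>R a"
    using is_reflection_coroot[OF t_reflection[OF i]] by metis
  moreover from this have "a \<noteq> 0" using linear_0 by fastforce
  ultimately have "\<rho> (t i) a \<noteq> a" by simp
  then have "a \<notin> H i" by (simp add: hyp_def fixed_space_def)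
  then show ?thesis by blast
qed

section \<open>Labels of covers and fixed spaces of products\<close>

lemma hyp_index_H: "j < length ss \<Longrightarrow> hyp_index W \<rho> ss (H j) = j"
  unfolding hyp_index_def by (rule the_equality) (simp, metis H_inj)

lemma arr_less_H_iff:
  assumes "i < length ss" "j < length ss"
  shows "arr_less W \<rho> ss (H j) (H i) \<longleftrightarrow> i < j"
proof
  assume "arr_less W \<rho> ss (H j) (H i)"
  then obtain i' j' where ij: "i' < j'" "j' < length ss" "H i = H i'" "H j = H j'"
    unfolding arr_less_def by blast
  then have "i = i'" "j = j'" using assms by (auto intro: H_inj)
  then show "i < j" using ij by simp
next
  assume "i < j"
  then show "arr_less W \<rho> ss (H j) (H i)" using assms unfolding arr_less_def by blast
qed

text \<open>Some hyperplane defining \<open>Y\<close> does not contain \<open>X\<close>, so a label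
  exists. Intersecting \<open>X\<close> with it gives a lattice element that contains
  \<open>Y\<close> and is strictly smaller than \<open>X\<close>; the covering relation forces it to
  be \<open>Y\<close>.\<close>

lemma covered_by_label:
  assumes "covered_by W \<rho> ss X Y"
  obtains j where "j < length ss" "edge_label W \<rho> ss X Y = H j" "Y = X \<inter> H j" "\<not> X \<subseteq> H j"
    "\<And>i. i < length ss \<Longrightarrow> Y \<subseteq> H i \<Longrightarrow> \<not> X \<subseteq> H i \<Longrightarrow> i \<le> j"
proof -
  let ?J = "{j. j < length ss \<and> Y \<subseteq> H j \<and> \<not> X \<subseteq> H j}"
  have lattice: "X \<in> int_lattice W \<rho> ss" "Y \<in> int_lattice W \<rho> ss" and YX: "Y \<subset> X"
    and nobetween: "\<And>Z. Z \<in> int_lattice W \<rho> ss \<Longrightarrow> Y \<subset> Z \<Longrightarrow> \<not> Z \<subset> X"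
    using assms unfolding covered_by_def by blast+
  obtain \<A> where A: "\<A> \<subseteq> arr W \<rho> ss" "X = \<Inter>\<A>"
    using lattice(1) unfolding int_lattice_def by blast
  obtain \<B> where \<B>: "\<B> \<subseteq> arr W \<rho> ss" "Y = \<Inter>\<B>"
    using lattice(2) unfolding int_lattice_def by blast
  have "\<not> X \<subseteq> \<Inter>\<B>" using YX \<B>(2) by simp
  then obtain K where K: "K \<in> \<B>" "\<not> X \<subseteq> K" by (meson Inter_greatest)
  then obtain n where "n < length ss" "K = H n" using \<B>(1) unfolding arr_def by blast
  moreover have "Y \<subseteq> K" using K(1) \<B>(2) by (simp add: Inter_lower)
  ultimately have "n \<in> ?J" using K(2) by simp
  then have ne: "?J \<noteq> {}" by (rule ex_in_conv[THEN iffD1, OF exI])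
  \<comment> \<open>The minimal hyperplane has the maximal index, since the order on the arrangement
    reverses the numbering.\<close>
  define j where "j = Max ?J"
  have fin: "finite ?J" by simp
  have j: "j \<in> ?J" unfolding j_def using Max_in[OF fin ne] .
  have max: "i \<le> j" if "i \<in> ?J" for i unfolding j_def using Max_ge[OF fin that] .
  define M where "M = {K \<in> arr W \<rho> ss. Y \<subseteq> K \<and> \<not> X \<subseteq> K}"
  have M: "M = H ` ?J" unfolding M_def arr_def by auto
  have "edge_label W \<rho> ss X Y = (THE K. K \<in> M \<and> (\<forall>L\<in>M. L \<noteq> K \<longrightarrow> arr_less W \<rho> ss K L))"
    unfolding edge_label_def M_def by (simp add: Let_def)
  also have "\<dots> = H j"
  proof (rule the_equality)
    show "H j \<in> M \<and> (\<forall>L\<in>M. L \<noteq> H j \<longrightarrow> arr_less W \<rho> ss (H j) L)"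
    proof (intro conjI ballI impI)
      show "H j \<in> M" unfolding M using j by blast
      fix L assume "L \<in> M" "L \<noteq> H j"
      then obtain i where i: "i \<in> ?J" "L = H i" "i \<noteq> j" unfolding M by blast
      then have "i < j" using max[OF i(1)] by simp
      then show "arr_less W \<rho> ss (H j) L" using i(1,2) j arr_less_H_iff[of i j] by simp
    qed
  next
    fix K assume K: "K \<in> M \<and> (\<forall>L\<in>M. L \<noteq> K \<longrightarrow> arr_less W \<rho> ss K L)"
    then obtain i where i: "i \<in> ?J" "K = H i" unfolding M by blast
    show "K = H j"
    proof (rule ccontr)
      assume "K \<noteq> H j"
      then have "arr_less W \<rho> ss (H i) (H j)" using K i(2) j unfolding M by simp
      then show False using arr_less_H_iff[of j i] i(1) j max[OF i(1)] by simp
    qed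
  qed
  finally have lab: "edge_label W \<rho> ss X Y = H j" .
  have "X \<inter> H j = \<Inter>(insert (H j) \<A>)" unfolding A(2) by (simp add: Int_commute)
  moreover have "insert (H j) \<A> \<subseteq> arr W \<rho> ss" using A(1) j unfolding arr_def by simp
  ultimately have "X \<inter> H j \<in> int_lattice W \<rho> ss" unfolding int_lattice_def by blast
  then have "\<not> (Y \<subset> X \<inter> H j \<and> X \<inter> H j \<subset> X)" using nobetween by blast
  moreover have "Y \<subseteq> X \<inter> H j" "X \<inter> H j \<subset> X" using j YX by auto
  ultimately have "Y = X \<inter> H j" by blast
  then show ?thesis using that[of j] j lab max by simp
qed

text \<open>The inductive step of Carter's lemma. If \<open>g \<otimes> t j\<close> fixes
  \<open>v\<close>, then \<open>t j\<close> and the inverse of \<open>g\<close> agree on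
  \<open>v\<close>, so the displacement of \<open>v\<close> is orthogonal to the fixed space of
  \<open>g\<close>. That space contains a vector moved by \<open>t j\<close>, so \<open>t j\<close>
  fixes \<open>v\<close>, and then so does \<open>g\<close>.\<close>

lemma fixed_space_mult_reflection:
  assumes "g \<in> carrier W" "j < length ss" "\<not> fixed_space \<rho> g \<subseteq> H j"
  shows "fixed_space \<rho> (g \<otimes> t j) = fixed_space \<rho> g \<inter> H j"
proof
  show "fixed_space \<rho> g \<inter> H j \<subseteq> fixed_space \<rho> (g \<otimes> t j)"
    using assms by (auto simp: fixed_space_def hyp_def rho_mult tref_closed)
  show "fixed_space \<rho> (g \<otimes> t j) \<subseteq> fixed_space \<rho> g \<inter> H j"
  proof
    fix v assume "v \<in> fixed_space \<rho> (g \<otimes> t j)"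
    then have v: "\<rho> g (\<rho> (t j) v) = v"
      using assms by (simp add: fixed_space_def rho_mult tref_closed)
    obtain x where x: "\<rho> g x = x" "\<rho> (t j) x \<noteq> x"
      using assms(3) by (auto simp: fixed_space_def hyp_def)
    have "\<rho> (t j) v = \<rho> (inv g) v" using v rho_inv(1)[OF assms(1)] by metis
    moreover have "\<rho> (inv g) x = x" using x rho_inv(1)[OF assms(1)] by metis
    ultimately have "B (\<rho> (t j) v - v) x = 0"
      using isometry_diff_orthogonal_fixed[of "\<rho> (inv g)"] rho_isometry assms(1) by simp
    then have "\<rho> (t j) v = v"
      using reflection_fixes_if_orthogonal x(2) t_reflection rho_isometry tref_closed assms(2) by blast
    then show "v \<in> fixed_space \<rho> g \<inter> H j" using v by (simp add: fixed_space_def hyp_def)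
  qed
qed

section \<open>Index sequences of decreasing chains\<close>

definition label_indices :: "'v set list \<Rightarrow> nat list" where
  "label_indices C = map (hyp_index W \<rho> ss) (chain_labels W \<rho> ss C)"

lemma chain_prod_eq: "chain_prod W \<rho> ss C = tprod (label_indices C)"
  by (simp add: chain_prod_def label_indices_def comp_def)

lemma chain_labels_snoc:
  "C \<noteq> [] \<Longrightarrow> chain_labels W \<rho> ss (C @ [X]) = chain_labels W \<rho> ss C @ [edge_label W \<rho> ss (last C) X]"
  unfolding chain_labels_def by (induction C rule: induct_list012) auto

lemma decreasing_chains_snocD:
  assumes "C @ [X] \<in> decreasing_chains W \<rho> ss" "C \<noteq> []"
  shows "C \<in> decreasing_chains W \<rho> ss" "covered_by W \<rho> ss (last C) X"
  using assms by (auto simp: decreasing_chains_def chain_labels_snoc successively_append_iff)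

text \<open>Each cover intersects the current space with the hyperplane of its label, and
  multiplying by the matching reflection does the same to the fixed space. The last clause bounds
  indices by some label, not by the last one, because the proof that the indices increase relies on
  this lemma.\<close>

lemma decreasing_chain_invariants:
  assumes "C \<in> decreasing_chains W \<rho> ss"
  shows "set (label_indices C) \<subseteq> {..<length ss} \<and>
    chain_labels W \<rho> ss C = map H (label_indices C) \<and>
    last C = fixed_space \<rho> (tprod (label_indices C)) \<and>
    (\<forall>j\<in>set (label_indices C). last C \<subseteq> H j) \<and>
    (\<forall>i<length ss. last C \<subseteq> H i \<longrightarrow> (\<exists>j\<in>set (label_indices C). i \<le> j))"
  using assms
proof (induction C rule: rev_induct)
  case Nil
  then show ?case by (simp add: decreasing_chains_def)
next
  case (snoc X C)
  show ?case
  proof (cases "C = []")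
    case True
    then have "X = UNIV" using snoc.prems by (simp add: decreasing_chains_def)
    \<comment> \<open>The one-element chain has no labels and product \<open>\<one>\<close>; no
      hyperplane of the arrangement contains the whole space.\<close>
    then show ?thesis using True H_neq_UNIV
      by (auto simp: label_indices_def chain_labels_def word_prod_Nil fixed_space_def rho_one)
  next
    case False
    note d = decreasing_chains_snocD[OF snoc.prems False]
    note IH = snoc.IH[OF d(1)]
    obtain j where j: "j < length ss" "edge_label W \<rho> ss (last C) X = H j" "X = last C \<inter> H j"
      "\<not> last C \<subseteq> H j" "\<And>i. i < length ss \<Longrightarrow> X \<subseteq> H i \<Longrightarrow> \<not> last C \<subseteq> H i \<Longrightarrow> i \<le> j"
      using covered_by_label[OF d(2)] by metis
    have idx: "label_indices (C @ [X]) = label_indices C @ [j]"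
      using False j by (simp add: label_indices_def chain_labels_snoc hyp_index_H)
    have "tprod (label_indices C @ [j]) = tprod (label_indices C) \<otimes> t j"
      using IH j(1) by (intro tprod_snoc) auto
    then have "fixed_space \<rho> (tprod (label_indices C @ [j])) = X"
      using IH j(3,4) fixed_space_mult_reflection[OF tprod_closed j(1), of "label_indices C"] by simp
    \<comment> \<open>A hyperplane containing \<open>X\<close> either contains \<open>last C\<close>
      already, or competes for the new label and so has index at most \<open>j\<close>.\<close>
    moreover have "\<exists>l\<in>set (label_indices C @ [j]). i \<le> l" if "i < length ss" "X \<subseteq> H i" for i
      using that IH j(5)[OF that] by (cases "last C \<subseteq> H i") auto
    moreover have "X \<subseteq> H l" if "l \<in> set (label_indices C @ [j])" for l
    proof (cases "l = j")
      case True
      then show ?thesis using j(3) by blast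
    next
      case False
      then have "l \<in> set (label_indices C)" using that by simp
      then have "last C \<subseteq> H l" using IH by blast
      then show ?thesis using j(3) by blast
    qed
    moreover have "set (label_indices C @ [j]) \<subseteq> {..<length ss}"
      using IH j(1) by simp
    moreover have "chain_labels W \<rho> ss (C @ [X]) = map H (label_indices C @ [j])"
      using False IH j(2) by (simp add: chain_labels_snoc)
    ultimately show ?thesis
      unfolding idx last_snoc by blast
  qed
qed

lemma label_indices_sorted:
  assumes "C \<in> decreasing_chains W \<rho> ss"
  shows "sorted_wrt (<) (label_indices C)"
proof -
  note inv = decreasing_chain_invariants[OF assms]
  have "successively (\<lambda>K L. arr_less W \<rho> ss L K) (map H (label_indices C))"
    using assms inv by (simp add: decreasing_chains_def)
  then have "successively (\<lambda>i j. arr_less W \<rho> ss (H j) (H i)) (label_indices C)"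
    by (simp add: successively_map)
  moreover have "x < length ss" if "x \<in> set (label_indices C)" for x
    using inv that by blast
  ultimately have "successively (<) (label_indices C)"
    using arr_less_H_iff by (elim successively_mono) simp_all
  then show ?thesis by (simp add: successively_conv_sorted_wrt)
qed

text \<open>The label indices increase, so the chain product deletes the letters at these positions
  from the reduced word.\<close>

lemma chain_map_in_bruhat_lower_interval:
  assumes "C \<in> decreasing_chains W \<rho> ss"
  shows "chain_map W \<rho> ss (word_prod W ss) C \<in> bruhat_lower_interval W S (word_prod W ss)"
proof -
  obtain us where "subseq us ss" "tprod (label_indices C) \<otimes> word_prod W ss = word_prod W us"
    using delete_letters[OF label_indices_sorted[OF assms], of 0] decreasing_chain_invariants[OF assms]
    by auto
  moreover from this have "set us \<subseteq> carrier W" using ss_carrier by (blast dest: subseq_set)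
  ultimately show ?thesis
    using reduced by (auto simp: bruhat_lower_interval_def bruhat_le_def chain_map_def chain_prod_eq
        word_prod_closed)
qed

section \<open>Recovering a chain from its product\<close>

lemma decreasing_chains_last_UNIV:
  assumes "C \<in> decreasing_chains W \<rho> ss" "last C = UNIV"
  shows "C = [UNIV]"
proof (cases C rule: rev_cases)
  case Nil
  then show ?thesis using assms by (simp add: decreasing_chains_def)
next
  case (snoc C' X)
  \<comment> \<open>A cover strictly shrinks the space, so a chain with at least one step cannot end
    in the whole space.\<close>
  have "C' = []"
  proof (rule ccontr)
    assume "C' \<noteq> []"
    then have "covered_by W \<rho> ss (last C') X" using assms snoc decreasing_chains_snocD by blast
    then show False using assms snoc by (auto simp: covered_by_def)
  qed
  then show ?thesis using snoc assms by simp
qed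

text \<open>The last label depends on \<open>X\<close> alone: its hyperplane contains
  \<open>X\<close>, every index of a hyperplane containing \<open>X\<close> is bounded by some label
  index, and the last label index is the largest.\<close>

lemma label_indices_snoc:
  assumes "C @ [X] \<in> decreasing_chains W \<rho> ss" "C \<noteq> []"
  shows "label_indices (C @ [X]) = label_indices C @ [Max {i. i < length ss \<and> X \<subseteq> H i}]"
proof -
  obtain j where idx: "label_indices (C @ [X]) = label_indices C @ [j]"
    using assms by (simp add: label_indices_def chain_labels_snoc)
  note inv = decreasing_chain_invariants[OF assms(1)]
  have "l \<le> j" if "l \<in> set (label_indices (C @ [X]))" for l
    using that label_indices_sorted[OF assms(1)] unfolding idx by (auto simp: sorted_wrt_append)
  then have "Max {i. i < length ss \<and> X \<subseteq> H i} = j"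
    using inv idx by (intro Max_eqI) (auto, meson le_trans)
  then show ?thesis using idx by simp
qed

text \<open>Chains are peeled from the end. Equal products have the same fixed space, so both chains
  end in the same \<open>X\<close> and carry the same last label; cancelling its reflection leaves
  truncated chains with equal products.\<close>

lemma chain_prod_inj: "inj_on (chain_prod W \<rho> ss) (decreasing_chains W \<rho> ss)"
proof (rule inj_onI)
  fix C D
  assume "C \<in> decreasing_chains W \<rho> ss" "D \<in> decreasing_chains W \<rho> ss"
    "chain_prod W \<rho> ss C = chain_prod W \<rho> ss D"
  then show "C = D"
  proof (induction C arbitrary: D rule: rev_induct)
    case Nil
    then show ?case by (simp add: decreasing_chains_def)
  next
    case (snoc X C)
    have last: "last D = X"
      using decreasing_chain_invariants[OF snoc.prems(1)] decreasing_chain_invariants[OF snoc.prems(2)]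
        snoc.prems(3) by (simp add: chain_prod_eq)
    show ?case
    proof (cases "X = UNIV")
      case True
      then show ?thesis using decreasing_chains_last_UNIV snoc.prems last by (metis last_snoc)
    next
      case False
      obtain D' where D: "D = D' @ [X]"
        using snoc.prems(2) last by (cases D rule: rev_cases) (auto simp: decreasing_chains_def)
      \<comment> \<open>A chain with a single element consists of the whole space, which
        \<open>X\<close> is not.\<close>
      have ne: "C \<noteq> []" "D' \<noteq> []"
        using snoc.prems False D by (auto simp: decreasing_chains_def)
      let ?j = "Max {i. i < length ss \<and> X \<subseteq> H i}"
      note C = decreasing_chains_snocD(1)[OF snoc.prems(1) ne(1)]
      note D' = decreasing_chains_snocD(1)[OF snoc.prems(2)[unfolded D] ne(2)]
      note idx = label_indices_snoc[OF snoc.prems(1) ne(1)]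
        label_indices_snoc[OF snoc.prems(2)[unfolded D] ne(2)]
      have j: "?j < length ss"
        using decreasing_chain_invariants[OF snoc.prems(1)] idx(1) by simp
      have sub: "set (label_indices C) \<subseteq> {..<length ss}" "set (label_indices D') \<subseteq> {..<length ss}"
        using decreasing_chain_invariants C D' by blast+
      have "tprod (label_indices C) \<otimes> t ?j = tprod (label_indices D') \<otimes> t ?j"
        using snoc.prems(3) unfolding chain_prod_eq D idx tprod_snoc[OF sub(1) j] tprod_snoc[OF sub(2) j] .
      then have "chain_prod W \<rho> ss C = chain_prod W \<rho> ss D'"
        using j sub by (simp add: chain_prod_eq tprod_closed tref_closed)
      then show ?thesis using snoc.IH[OF C D'] D by simp
    qed
  qed
qed

lemma chain_map_inj: "inj_on (chain_map W \<rho> ss (word_prod W ss)) (decreasing_chains W \<rho> ss)"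
proof (rule inj_onI)
  fix C D
  assume CD: "C \<in> decreasing_chains W \<rho> ss" "D \<in> decreasing_chains W \<rho> ss"
    and eq: "chain_map W \<rho> ss (word_prod W ss) C = chain_map W \<rho> ss (word_prod W ss) D"
  have "chain_prod W \<rho> ss C \<in> carrier W" "chain_prod W \<rho> ss D \<in> carrier W"
    using decreasing_chain_invariants CD by (simp_all add: chain_prod_eq tprod_closed)
  then have "chain_prod W \<rho> ss C = chain_prod W \<rho> ss D"
    using eq ss_carrier by (simp add: chain_map_def word_prod_closed)
  then show "C = D" using chain_prod_inj CD by (auto dest: inj_onD)
qed

end

section \<open>From the Coxeter system to the reflection word\<close>

lemma coxeter_system_involution:
  assumes "coxeter_system W S" "s \<in> S"
  shows "s \<otimes>\<^bsub>W\<^esub> s = \<one>\<^bsub>W\<^esub>"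
proof -
  interpret group W using assms by (simp add: coxeter_system_def)
  obtain m where m: "coxeter_matrix S m"
      "\<forall>u\<in>lists S. \<forall>v\<in>lists S. word_prod W u = word_prod W v \<longleftrightarrow> equivclp (relator_step S m) u v"
    using assms(1) unfolding coxeter_system_def by blast
  \<comment> \<open>Since \<open>m s s = 1\<close>, the word \<open>[s, s]\<close> is itself a
    relator.\<close>
  have "relator_step S m [s, s] []"
    using m(1) assms(2) unfolding relator_step_def coxeter_matrix_def
    by (intro exI[of _ "[]"] exI[of _ s]) simp
  then have "word_prod W [s, s] = word_prod W []"
    using m(2) assms(2) by (simp add: r_into_equivclp)
  moreover have "s \<in> carrier W" using assms unfolding coxeter_system_def by blast
  ultimately show ?thesis by (simp add: word_prod_Cons word_prod_Nil)
qed

theorem theorem3p3: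
  fixes W :: "('g, 'z) monoid_scheme"
    and S :: "'g set"
    and \<rho> :: "'g \<Rightarrow> 'v::real_vector \<Rightarrow> 'v"
    and w :: 'g
    and ss :: "'g list"
  assumes "coxeter_system W S"
    and "finite (carrier W)"
    and "reflection_realization W S \<rho>"
    and "reduced_expression W S w ss"
  shows "chain_map W \<rho> ss w \<in> decreasing_chains W \<rho> ss \<rightarrow> bruhat_lower_interval W S w
       \<and> inj_on (chain_map W \<rho> ss w) (decreasing_chains W \<rho> ss)"
proof -
  have W: "group W" "S \<subseteq> carrier W" "generate W S = carrier W"
    using assms(1) unfolding coxeter_system_def by blast+
  have w: "w = word_prod W ss" using assms(4) unfolding reduced_expression_def by simp
  \<comment> \<open>Finiteness of W enters here, through the averaged form.\<close>
  obtain B where B: "definite_form B" "\<And>g. g \<in> carrier W \<Longrightarrow> definite_form.isometry B (\<rho> g)"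
    using reflection_realization_invariant_form[OF W(1) assms(2) W(2,3) assms(3)] by blast
  interpret reflection_word W B S \<rho> ss
    using W B assms coxeter_system_involution[OF assms(1)] w
    by (intro reflection_word.intro reflection_word_axioms.intro) auto
  show ?thesis
    unfolding w using chain_map_in_bruhat_lower_interval chain_map_inj by blast
qed

end
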